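(* Let $(A,\mu)\in\mathcal C$, let $M$ be an $A$-bimodule and let $H$ be a 2-cocycle on $A$ with values in $M$. Also, let $\mathrm T:M\to A$ be an $H$-twisted Rota-Baxter operator. Then $(M,\prec,\succ,\vee)$ is a $\mathcal C$-NS-algebra with the products given for all $m,m'\in M$ by $$m\prec m':=m\cdot\mathrm T(m'),\quad m\succ m':=\mathrm T(m)\cdot m',\quad m\vee m':=H(\mathrm T(m)\otimes\mathrm T(m')).$$
   Context: Fix a commutative ring $R$; all modules, tensor products and linear maps are over $R$. An algebra $(A,\mu_1,\dots,\mu_s)$ is an $R$-module $A$ with linear maps (products) $\mu_i:A\otimes A\to A$; no associativity or unit is assumed. For a single product write $ab=\mu(a\otimes b)$. Fix a collection of multilinear relations $\mathcal R_1=0,\dots,\mathcal R_k=0$ in one binary product: an $n$-linear relation is an $R$-linear combination of parenthesized (non-associative) monomials in $x_1,\dots,x_n$, each variable occurring exactly once in each monomial. $\mathcal C$ is the category of all algebras $(A,\mu)$ in which these relations hold for all substitutions of elements of $A$; $(A,\mu)\in\mathcal C$ means that $(A,\mu)$ satisfies all of them. Bimodule: let $(A,\mu)\in\mathcal C$ and let $M$ be an $R$-module with linear maps $l,r:A\to\mathrm{End}(M)$, written $a\cdot m:=l(a)(m)$ and $m\cdot a:=r(a)(m)$ (left and right actions). $(M,l,r)$, or simply $M$, is an $A$-bimodule if $A\oplus M$ with the product $(a,m)*(a',m'):=(aa',a\cdot m'+m\cdot a')$ belongs to $\mathcal C$. 2-cocycle on $A$ with values in an $A$-bimodule $M$: a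 linear map $H:A\otimes A\to M$ such that $A\oplus M$ with the product $(a,m)*_H(a',m'):=(aa',a\cdot m'+m\cdot a'+H(a\otimes a'))$ belongs to $\mathcal C$. $H$-twisted Rota-Baxter operator on $M$ (for $H$ a 2-cocycle on $A$ with values in $M$): a linear map $\mathrm T:M\to A$ with $\mathrm T(m)\mathrm T(m')=\mathrm T\big(\mathrm T(m)\cdot m'+m\cdot\mathrm T(m')+H(\mathrm T(m)\otimes\mathrm T(m'))\big)$ for all $m,m'\in M$. $\mathcal C$-NS-algebra: an algebra $(A,\prec,\succ,\vee)$ with three products such that $(A\oplus A,\boxtimes)\in\mathcal C$, where $(a,x)\boxtimes(a',x'):=(a\star a',\,a\succ x'+x\prec a')$ and $a\star a':=a\succ a'+a\prec a'+a\vee a'$. *)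

theory Defs
  imports "HOL-Algebra.Module" "HOL-Library.Multiset"
begin

text \<open>
  A linear map out of a tensor product \<open>M \<otimes> N\<close> is given as
  the corresponding bilinear map on \<open>M \<times> N\<close>, and a linear map from \<open>A\<close> to the endomorphisms
  of \<open>M\<close> as a bilinear map \<open>A \<times> M \<rightarrow> M\<close>. Maps are HOL functions of which only the
  restriction to the carriers matters.
\<close>

definition linear_map ::
  "('r, 'x) ring_scheme \<Rightarrow> ('r, 'a, 'p) module_scheme \<Rightarrow> ('r, 'b, 'q) module_scheme
    \<Rightarrow> ('a \<Rightarrow> 'b) \<Rightarrow> bool"
  where "linear_map R M N f \<longleftrightarrow>
    f \<in> carrier M \<rightarrow> carrier N \<and>
    (\<forall>x\<in>carrier M. \<forall>y\<in>carrier M. f (x \<oplus>\<^bsub>M\<^esub> y) = f x \<oplus>\<^bsub>N\<^esub> f y) \<and>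
    (\<forall>c\<in>carrier R. \<forall>x\<in>carrier M. f (c \<odot>\<^bsub>M\<^esub> x) = c \<odot>\<^bsub>N\<^esub> f x)"

definition bilinear_map ::
  "('r, 'x) ring_scheme \<Rightarrow> ('r, 'a, 'p) module_scheme \<Rightarrow> ('r, 'b, 'q) module_scheme
    \<Rightarrow> ('r, 'c, 's) module_scheme \<Rightarrow> ('a \<Rightarrow> 'b \<Rightarrow> 'c) \<Rightarrow> bool"
  where "bilinear_map R M N P f \<longleftrightarrow>
    (\<forall>x\<in>carrier M. linear_map R N P (\<lambda>y. f x y)) \<and>
    (\<forall>y\<in>carrier N. linear_map R M P (\<lambda>x. f x y))"

text \<open>The ring multiplication and unit fields of a module record play no role in \<^locale>\<open>module\<close>.\<close>

definition direct_sum ::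
  "('r, 'a, 'p) module_scheme \<Rightarrow> ('r, 'b, 'q) module_scheme \<Rightarrow> ('r, 'a \<times> 'b) module"
  where "direct_sum A M =
    \<lparr>carrier = carrier A \<times> carrier M,
     monoid.mult = undefined,
     one = undefined,
     zero = (\<zero>\<^bsub>A\<^esub>, \<zero>\<^bsub>M\<^esub>),
     add = (\<lambda>(a, m) (a', m'). (a \<oplus>\<^bsub>A\<^esub> a', m \<oplus>\<^bsub>M\<^esub> m')),
     smult = (\<lambda>c (a, m). (c \<odot>\<^bsub>A\<^esub> a, c \<odot>\<^bsub>M\<^esub> m))\<rparr>"

definition nonassoc_algebra ::
  "('r, 'x) ring_scheme \<Rightarrow> ('r, 'a, 'p) module_scheme \<Rightarrow> ('a \<Rightarrow> 'a \<Rightarrow> 'a) \<Rightarrow> bool"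
  where "nonassoc_algebra R A \<mu> \<longleftrightarrow> module R A \<and> bilinear_map R A A A \<mu>"

text \<open>Parenthesized monomials; \<open>Var i\<close> stands for \<open>x\<^sub>i\<close>.\<close>

datatype nonassoc_monomial = Var nat | Times nonassoc_monomial nonassoc_monomial

primrec monomial_vars :: "nonassoc_monomial \<Rightarrow> nat multiset" where
  "monomial_vars (Var i) = {#i#}"
| "monomial_vars (Times s t) = monomial_vars s + monomial_vars t"

primrec eval_monomial ::
  "('a \<Rightarrow> 'a \<Rightarrow> 'a) \<Rightarrow> (nat \<Rightarrow> 'a) \<Rightarrow> nonassoc_monomial \<Rightarrow> 'a" where
  "eval_monomial \<mu> x (Var i) = x i"
| "eval_monomial \<mu> x (Times s t) = \<mu> (eval_monomial \<mu> x s) (eval_monomial \<mu> x t)"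

text \<open>A formal linear combination is a list of pairs (coefficient, monomial).\<close>

type_synonym 'r relator = "('r \<times> nonassoc_monomial) list"

definition multilinear_relator :: "('r, 'x) ring_scheme \<Rightarrow> nat \<Rightarrow> 'r relator \<Rightarrow> bool"
  where "multilinear_relator R n \<rho> \<longleftrightarrow>
    (\<forall>(c, t)\<in>set \<rho>. c \<in> carrier R \<and> monomial_vars t = mset_set {1..n})"

primrec eval_relator ::
  "('r, 'a, 'p) module_scheme \<Rightarrow> ('a \<Rightarrow> 'a \<Rightarrow> 'a) \<Rightarrow> (nat \<Rightarrow> 'a) \<Rightarrow> 'r relator \<Rightarrow> 'a" where
  "eval_relator A \<mu> x [] = \<zero>\<^bsub>A\<^esub>"
| "eval_relator A \<mu> x (ct # \<rho>) =
    (fst ct \<odot>\<^bsub>A\<^esub> eval_monomial \<mu> x (snd ct)) \<oplus>\<^bsub>A\<^esub> eval_relator A \<mu> x \<rho>"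

definition satisfies_relation ::
  "('r, 'a, 'p) module_scheme \<Rightarrow> ('a \<Rightarrow> 'a \<Rightarrow> 'a) \<Rightarrow> 'r relator \<Rightarrow> bool"
  where "satisfies_relation A \<mu> \<rho> \<longleftrightarrow>
    (\<forall>x \<in> UNIV \<rightarrow> carrier A. eval_relator A \<mu> x \<rho> = \<zero>\<^bsub>A\<^esub>)"

definition in_category ::
  "('r, 'x) ring_scheme \<Rightarrow> 'r relator list \<Rightarrow> ('r, 'a, 'p) module_scheme
    \<Rightarrow> ('a \<Rightarrow> 'a \<Rightarrow> 'a) \<Rightarrow> bool"
  where "in_category R rels A \<mu> \<longleftrightarrow>
    nonassoc_algebra R A \<mu> \<and> (\<forall>\<rho>\<in>set rels. satisfies_relation A \<mu> \<rho>)"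

text \<open>Throughout, \<open>l a m\<close> is \<open>a \<cdot> m\<close> and \<open>r a m\<close> is \<open>m \<cdot> a\<close>.\<close>

definition bimodule ::
  "('r, 'x) ring_scheme \<Rightarrow> 'r relator list \<Rightarrow> ('r, 'a, 'p) module_scheme
    \<Rightarrow> ('a \<Rightarrow> 'a \<Rightarrow> 'a) \<Rightarrow> ('r, 'm, 'q) module_scheme
    \<Rightarrow> ('a \<Rightarrow> 'm \<Rightarrow> 'm) \<Rightarrow> ('a \<Rightarrow> 'm \<Rightarrow> 'm) \<Rightarrow> bool"
  where "bimodule R rels A \<mu> M l r \<longleftrightarrow>
    module R M \<and> bilinear_map R A M M l \<and> bilinear_map R A M M r \<and>
    in_category R rels (direct_sum A M)
      (\<lambda>(a, m) (a', m'). (\<mu> a a', l a m' \<oplus>\<^bsub>M\<^esub> r a' m))"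

definition two_cocycle ::
  "('r, 'x) ring_scheme \<Rightarrow> 'r relator list \<Rightarrow> ('r, 'a, 'p) module_scheme
    \<Rightarrow> ('a \<Rightarrow> 'a \<Rightarrow> 'a) \<Rightarrow> ('r, 'm, 'q) module_scheme
    \<Rightarrow> ('a \<Rightarrow> 'm \<Rightarrow> 'm) \<Rightarrow> ('a \<Rightarrow> 'm \<Rightarrow> 'm) \<Rightarrow> ('a \<Rightarrow> 'a \<Rightarrow> 'm) \<Rightarrow> bool"
  where "two_cocycle R rels A \<mu> M l r H \<longleftrightarrow>
    bilinear_map R A A M H \<and>
    in_category R rels (direct_sum A M)
      (\<lambda>(a, m) (a', m'). (\<mu> a a', (l a m' \<oplus>\<^bsub>M\<^esub> r a' m) \<oplus>\<^bsub>M\<^esub> H a a'))"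

definition twisted_rota_baxter ::
  "('r, 'x) ring_scheme \<Rightarrow> ('r, 'a, 'p) module_scheme
    \<Rightarrow> ('a \<Rightarrow> 'a \<Rightarrow> 'a) \<Rightarrow> ('r, 'm, 'q) module_scheme
    \<Rightarrow> ('a \<Rightarrow> 'm \<Rightarrow> 'm) \<Rightarrow> ('a \<Rightarrow> 'm \<Rightarrow> 'm) \<Rightarrow> ('a \<Rightarrow> 'a \<Rightarrow> 'm) \<Rightarrow> ('m \<Rightarrow> 'a) \<Rightarrow> bool"
  where "twisted_rota_baxter R A \<mu> M l r H T \<longleftrightarrow>
    linear_map R M A T \<and>
    (\<forall>m\<in>carrier M. \<forall>m'\<in>carrier M.
      \<mu> (T m) (T m') =
        T ((l (T m) m' \<oplus>\<^bsub>M\<^esub> r (T m') m) \<oplus>\<^bsub>M\<^esub> H (T m) (T m')))"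

text \<open>The arguments \<open>pr\<close>, \<open>sc\<close> and \<open>ve\<close> are the products \<open>\<prec>\<close>, \<open>\<succ>\<close> and \<open>\<or>\<close>.\<close>

definition ns_algebra ::
  "('r, 'x) ring_scheme \<Rightarrow> 'r relator list \<Rightarrow> ('r, 'a, 'p) module_scheme
    \<Rightarrow> ('a \<Rightarrow> 'a \<Rightarrow> 'a) \<Rightarrow> ('a \<Rightarrow> 'a \<Rightarrow> 'a) \<Rightarrow> ('a \<Rightarrow> 'a \<Rightarrow> 'a) \<Rightarrow> bool"
  where "ns_algebra R rels A pr sc ve \<longleftrightarrow>
    module R A \<and>
    bilinear_map R A A A pr \<and> bilinear_map R A A A sc \<and> bilinear_map R A A A ve \<and>
    in_category R rels (direct_sum A A)
      (\<lambda>(a, x) (a', x').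
        ((sc a a' \<oplus>\<^bsub>A\<^esub> pr a a') \<oplus>\<^bsub>A\<^esub> ve a a', sc a x' \<oplus>\<^bsub>A\<^esub> pr x a'))"

end

theory Submission
  imports Defs
begin

text \<open>
  The map \<open>m \<mapsto> (T m, m)\<close> embeds \<open>M\<close> with the product \<open>\<star>\<close> into \<open>A \<oplus> M\<close> with the product
  twisted by \<open>H\<close>; this is exactly the Rota-Baxter identity. The map \<open>(m, x) \<mapsto> (T m, x)\<close> is a
  homomorphism from \<open>M \<oplus> M\<close> with the product \<open>\<boxtimes>\<close> to the semidirect product \<open>A \<oplus> M\<close>. The first map
  composed with the first projection and the second map are jointly injective on \<open>M \<oplus> M\<close>, so
  every relation that holds in both targets holds in \<open>M \<oplus> M\<close>.
\<close>

section \<open>Linear and bilinear maps\<close>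

lemma linear_mapI:
  assumes "\<And>x. x \<in> carrier M \<Longrightarrow> f x \<in> carrier N"
    and "\<And>x y. x \<in> carrier M \<Longrightarrow> y \<in> carrier M \<Longrightarrow> f (x \<oplus>\<^bsub>M\<^esub> y) = f x \<oplus>\<^bsub>N\<^esub> f y"
    and "\<And>c x. c \<in> carrier R \<Longrightarrow> x \<in> carrier M \<Longrightarrow> f (c \<odot>\<^bsub>M\<^esub> x) = c \<odot>\<^bsub>N\<^esub> f x"
  shows "linear_map R M N f"
  using assms by (auto simp: linear_map_def)

lemma linear_map_closed: "linear_map R M N f \<Longrightarrow> x \<in> carrier M \<Longrightarrow> f x \<in> carrier N"
  by (auto simp: linear_map_def)

lemma linear_map_add:
  "linear_map R M N f \<Longrightarrow> x \<in> carrier M \<Longrightarrow> y \<in> carrier M \<Longrightarrow>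
    f (x \<oplus>\<^bsub>M\<^esub> y) = f x \<oplus>\<^bsub>N\<^esub> f y"
  by (auto simp: linear_map_def)

lemma linear_map_smult:
  "linear_map R M N f \<Longrightarrow> c \<in> carrier R \<Longrightarrow> x \<in> carrier M \<Longrightarrow>
    f (c \<odot>\<^bsub>M\<^esub> x) = c \<odot>\<^bsub>N\<^esub> f x"
  by (auto simp: linear_map_def)

text \<open>Additivity gives f 0 + f 0 = f 0, and cancelling in the codomain leaves f 0 = 0. The
  definition \<open>linear_map\<close> does not list this, and the empty relator evaluates to
  zero.\<close>

lemma linear_map_zero:
  assumes "module R M" "module R N" "linear_map R M N f"
  shows "f \<zero>\<^bsub>M\<^esub> = \<zero>\<^bsub>N\<^esub>"
proof -
  interpret M: module R M by fact
  interpret N: module R N by fact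
  have "f \<zero>\<^bsub>M\<^esub> \<oplus>\<^bsub>N\<^esub> f \<zero>\<^bsub>M\<^esub> = f \<zero>\<^bsub>M\<^esub>"
    using linear_map_add[OF assms(3), of "\<zero>\<^bsub>M\<^esub>" "\<zero>\<^bsub>M\<^esub>"] by simp
  moreover have "f \<zero>\<^bsub>M\<^esub> \<in> carrier N"
    using linear_map_closed[OF assms(3)] by simp
  ultimately show ?thesis by (simp add: N.add.l_cancel_one)
qed

lemma linear_map_id: "linear_map R M M (\<lambda>x. x)"
  by (simp add: linear_map_def)

lemma linear_map_compose:
  assumes "linear_map R M N f" "linear_map R N P g"
  shows "linear_map R M P (\<lambda>x. g (f x))"
  using assms by (auto simp: linear_map_def Pi_iff)

lemma linear_map_sum:
  assumes "module R N" "linear_map R M N f" "linear_map R M N g"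
  shows "linear_map R M N (\<lambda>x. f x \<oplus>\<^bsub>N\<^esub> g x)"
proof -
  interpret N: module R N by fact
  show ?thesis
    by (intro linear_mapI)
      (simp_all add: linear_map_closed[OF assms(2)] linear_map_closed[OF assms(3)]
        linear_map_add[OF assms(2)] linear_map_add[OF assms(3)]
        linear_map_smult[OF assms(2)] linear_map_smult[OF assms(3)]
        N.smult_r_distr N.add.m_ac)
qed

lemma bilinear_map_sum:
  assumes "module R P" "bilinear_map R M N P f" "bilinear_map R M N P g"
  shows "bilinear_map R M N P (\<lambda>x y. f x y \<oplus>\<^bsub>P\<^esub> g x y)"
  using assms by (simp add: bilinear_map_def linear_map_sum)

text \<open>Serves to insert \<open>T\<close>, the identity or a projection into each slot
  separately. With one slot fixed at a value in the carrier, what remains is a composite of two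
  linear maps.\<close>

lemma bilinear_map_compose:
  assumes "bilinear_map R M' N' P f" "linear_map R M M' g" "linear_map R N N' h"
  shows "bilinear_map R M N P (\<lambda>x y. f (g x) (h y))"
  unfolding bilinear_map_def
proof (intro conjI ballI)
  fix x assume "x \<in> carrier M"
  then have "linear_map R N' P (f (g x))"
    using assms(1) linear_map_closed[OF assms(2)] by (simp add: bilinear_map_def)
  then show "linear_map R N P (\<lambda>y. f (g x) (h y))"
    by (rule linear_map_compose[OF assms(3)])
next
  fix y assume "y \<in> carrier N"
  then have "linear_map R M' P (\<lambda>x. f x (h y))"
    using assms(1) linear_map_closed[OF assms(3)] by (simp add: bilinear_map_def)
  then show "linear_map R M P (\<lambda>x. f (g x) (h y))"
    by (rule linear_map_compose[OF assms(2)])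
qed

lemma bilinear_map_flip:
  "bilinear_map R M N P f \<Longrightarrow> bilinear_map R N M P (\<lambda>y x. f x y)"
  by (auto simp: bilinear_map_def)

lemma bilinear_map_closed:
  "bilinear_map R M N P f \<Longrightarrow> x \<in> carrier M \<Longrightarrow> y \<in> carrier N \<Longrightarrow> f x y \<in> carrier P"
  by (auto simp: bilinear_map_def linear_map_def)

section \<open>Direct sums\<close>

text \<open>Projections replace the pattern matching of \<open>direct_sum\<close>, so that the rules
  also apply to elements not displayed as pairs.\<close>

lemma direct_sum_simps [simp]:
  "carrier (direct_sum A M) = carrier A \<times> carrier M"
  "\<zero>\<^bsub>direct_sum A M\<^esub> = (\<zero>\<^bsub>A\<^esub>, \<zero>\<^bsub>M\<^esub>)"
  "p \<oplus>\<^bsub>direct_sum A M\<^esub> q = (fst p \<oplus>\<^bsub>A\<^esub> fst q, snd p \<oplus>\<^bsub>M\<^esub> snd q)"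
  "c \<odot>\<^bsub>direct_sum A M\<^esub> p = (c \<odot>\<^bsub>A\<^esub> fst p, c \<odot>\<^bsub>M\<^esub> snd p)"
  by (simp_all add: direct_sum_def case_prod_beta)

lemma module_direct_sum:
  assumes "module R A" "module R M"
  shows "module R (direct_sum A M)"
proof -
  interpret A: module R A by fact
  interpret M: module R M by fact
  show ?thesis
  proof (intro module.intro module_axioms.intro abelian_groupI)
    fix p assume p: "p \<in> carrier (direct_sum A M)"
    show "\<exists>q\<in>carrier (direct_sum A M). q \<oplus>\<^bsub>direct_sum A M\<^esub> p = \<zero>\<^bsub>direct_sum A M\<^esub>"
      using p by (intro bexI[of _ "(\<ominus>\<^bsub>A\<^esub> fst p, \<ominus>\<^bsub>M\<^esub> snd p)"]) (auto simp: A.l_neg M.l_neg)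
  qed (auto simp: A.is_cring A.add.m_ac M.add.m_ac A.smult_l_distr M.smult_l_distr
      A.smult_r_distr M.smult_r_distr A.smult_assoc1 M.smult_assoc1)
qed

lemma linear_map_fst: "linear_map R (direct_sum A M) A fst"
  by (auto simp: linear_map_def)

lemma linear_map_snd: "linear_map R (direct_sum A M) M snd"
  by (auto simp: linear_map_def)

lemma linear_map_Pair:
  assumes "linear_map R N A f" "linear_map R N M g"
  shows "linear_map R N (direct_sum A M) (\<lambda>x. (f x, g x))"
  using assms by (auto simp: linear_map_def)

lemma bilinear_map_Pair:
  assumes "bilinear_map R M N A f" "bilinear_map R M N B g"
  shows "bilinear_map R M N (direct_sum A B) (\<lambda>x y. (f x y, g x y))"
  using assms by (simp add: bilinear_map_def linear_map_Pair)

section \<open>Relations and homomorphisms\<close>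

definition algebra_hom ::
  "('r, 'x) ring_scheme \<Rightarrow> ('r, 'a, 'p) module_scheme \<Rightarrow> ('a \<Rightarrow> 'a \<Rightarrow> 'a)
    \<Rightarrow> ('r, 'b, 'q) module_scheme \<Rightarrow> ('b \<Rightarrow> 'b \<Rightarrow> 'b) \<Rightarrow> ('a \<Rightarrow> 'b) \<Rightarrow> bool"
  where "algebra_hom R A \<mu> B \<nu> f \<longleftrightarrow> linear_map R A B f \<and>
    (\<forall>x\<in>carrier A. \<forall>y\<in>carrier A. f (\<mu> x y) = \<nu> (f x) (f y))"

lemma eval_monomial_closed:
  assumes "nonassoc_algebra R A \<mu>" "x \<in> UNIV \<rightarrow> carrier A"
  shows "eval_monomial \<mu> x t \<in> carrier A"
  using assms by (induction t) (auto simp: nonassoc_algebra_def intro: bilinear_map_closed)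

text \<open>Multiplicativity of \<open>f\<close> is known on the carrier only, so the step for
  \<open>Times\<close> relies on both factors evaluating into it.\<close>

lemma eval_monomial_hom:
  assumes "nonassoc_algebra R A \<mu>" "algebra_hom R A \<mu> B \<nu> f" "x \<in> UNIV \<rightarrow> carrier A"
  shows "f (eval_monomial \<mu> x t) = eval_monomial \<nu> (\<lambda>i. f (x i)) t"
  using assms(2) eval_monomial_closed[OF assms(1,3)]
  by (induction t) (auto simp: algebra_hom_def)

lemma eval_relator_closed:
  assumes "nonassoc_algebra R A \<mu>" "x \<in> UNIV \<rightarrow> carrier A" "fst ` set \<rho> \<subseteq> carrier R"
  shows "eval_relator A \<mu> x \<rho> \<in> carrier A"
proof -
  interpret module R A using assms(1) by (simp add: nonassoc_algebra_def)
  show ?thesis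
    using assms(3) by (induction \<rho>) (auto simp: eval_monomial_closed[OF assms(1,2)])
qed

text \<open>Linearity moves \<open>f\<close> through the combination term by term, and
  multiplicativity moves it through each monomial.\<close>

lemma eval_relator_hom:
  assumes "nonassoc_algebra R A \<mu>" "module R B" "algebra_hom R A \<mu> B \<nu> f"
    and "x \<in> UNIV \<rightarrow> carrier A" "fst ` set \<rho> \<subseteq> carrier R"
  shows "f (eval_relator A \<mu> x \<rho>) = eval_relator B \<nu> (\<lambda>i. f (x i)) \<rho>"
proof -
  interpret module R A using assms(1) by (simp add: nonassoc_algebra_def)
  have f: "linear_map R A B f"
    using assms(3) by (simp add: algebra_hom_def)
  show ?thesis
    using assms(5)
    by (induction \<rho>)
      (simp_all add: linear_map_zero[OF module_axioms assms(2) f] linear_map_add[OF f]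
        linear_map_smult[OF f] eval_monomial_closed[OF assms(1,4)]
        eval_relator_closed[OF assms(1,4)] eval_monomial_hom[OF assms(1,3,4)])
qed

text \<open>The value of a relator at \<open>x\<close> is sent by \<open>f\<close> and by
  \<open>g\<close> to its values at the image substitutions. Both vanish by the relations in
  \<open>B\<close> and \<open>C\<close>, so the value lies in the common kernel of \<open>f\<close>
  and \<open>g\<close>, which \<open>inj\<close> makes trivial.\<close>

lemma in_category_jointly_injective:
  assumes "\<forall>\<rho>\<in>set rels. \<exists>n. multilinear_relator R n \<rho>"
    and A: "nonassoc_algebra R A \<mu>"
    and B: "in_category R rels B \<nu>" and C: "in_category R rels C \<kappa>"
    and f: "algebra_hom R A \<mu> B \<nu> f" and g: "algebra_hom R A \<mu> C \<kappa> g"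
    and inj: "\<And>a. a \<in> carrier A \<Longrightarrow> f a = \<zero>\<^bsub>B\<^esub> \<Longrightarrow> g a = \<zero>\<^bsub>C\<^esub> \<Longrightarrow> a = \<zero>\<^bsub>A\<^esub>"
  shows "in_category R rels A \<mu>"
  unfolding in_category_def satisfies_relation_def
proof (intro conjI ballI)
  fix \<rho> and x :: "nat \<Rightarrow> 'c" assume \<rho>: "\<rho> \<in> set rels" and x: "x \<in> UNIV \<rightarrow> carrier A"
  \<comment> \<open>Multilinearity enters through the membership of the coefficients in
    \<open>R\<close>, which lets linearity of \<open>f\<close> and \<open>g\<close> act on the
    scalars.\<close>
  have coeffs: "fst ` set \<rho> \<subseteq> carrier R"
    using assms(1) \<rho> by (fastforce simp: multilinear_relator_def)
  have mods: "module R B" "module R C"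
    using B C by (simp_all add: in_category_def nonassoc_algebra_def)
  have "(\<lambda>i. f (x i)) \<in> UNIV \<rightarrow> carrier B" "(\<lambda>i. g (x i)) \<in> UNIV \<rightarrow> carrier C"
    using f g x by (auto simp: algebra_hom_def linear_map_def)
  then show "eval_relator A \<mu> x \<rho> = \<zero>\<^bsub>A\<^esub>"
    using B C \<rho>
    by (intro inj)
      (simp_all add: eval_relator_closed[OF A x coeffs] in_category_def satisfies_relation_def
        eval_relator_hom[OF A mods(1) f x coeffs] eval_relator_hom[OF A mods(2) g x coeffs])
qed (fact A)

section \<open>Twisted Rota-Baxter operators\<close>

theorem proposition6p4:
  fixes R :: "('r, 'x) ring_scheme"
    and rels :: "'r relator list"
    and A :: "('r, 'a, 'p) module_scheme"
    and \<mu> :: "'a \<Rightarrow> 'a \<Rightarrow> 'a"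
    and M :: "('r, 'm, 'q) module_scheme"
    and l r :: "'a \<Rightarrow> 'm \<Rightarrow> 'm"
    and H :: "'a \<Rightarrow> 'a \<Rightarrow> 'm"
    and T :: "'m \<Rightarrow> 'a"
  assumes "cring R"
    and "\<forall>\<rho>\<in>set rels. \<exists>n. multilinear_relator R n \<rho>"
    and "in_category R rels A \<mu>"
    and "bimodule R rels A \<mu> M l r"
    and "two_cocycle R rels A \<mu> M l r H"
    and "twisted_rota_baxter R A \<mu> M l r H T"
  shows "ns_algebra R rels M
    (\<lambda>m m'. r (T m') m)
    (\<lambda>m m'. l (T m) m')
    (\<lambda>m m'. H (T m) (T m'))"
proof -
  let ?pr = "\<lambda>m m'. r (T m') m"
  let ?sc = "\<lambda>m m'. l (T m) m'"
  let ?ve = "\<lambda>m m'. H (T m) (T m')"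
  let ?star = "\<lambda>m m'. (?sc m m' \<oplus>\<^bsub>M\<^esub> ?pr m m') \<oplus>\<^bsub>M\<^esub> ?ve m m'"
  let ?box = "\<lambda>(m, x) (m', x'). (?star m m', ?sc m x' \<oplus>\<^bsub>M\<^esub> ?pr x m')"
  let ?semi = "\<lambda>(a, m) (a', m'). (\<mu> a a', l a m' \<oplus>\<^bsub>M\<^esub> r a' m)"
  let ?twisted = "\<lambda>(a, m) (a', m'). (\<mu> a a', (l a m' \<oplus>\<^bsub>M\<^esub> r a' m) \<oplus>\<^bsub>M\<^esub> H a a')"
  have modM: "module R M" and l: "bilinear_map R A M M l" and r: "bilinear_map R A M M r"
    and semi: "in_category R rels (direct_sum A M) ?semi"
    using assms(4) by (simp_all add: bimodule_def)
  have H: "bilinear_map R A A M H" and twisted: "in_category R rels (direct_sum A M) ?twisted"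
    using assms(5) by (simp_all add: two_cocycle_def)
  have T: "linear_map R M A T"
    and rota_baxter: "\<And>m m'. m \<in> carrier M \<Longrightarrow> m' \<in> carrier M \<Longrightarrow> \<mu> (T m) (T m') = T (?star m m')"
    using assms(6) by (simp_all add: twisted_rota_baxter_def)
  interpret M: module R M by (fact modM)
  \<comment> \<open>\<open>r\<close> takes the algebra element first, whereas in \<open>?pr\<close>
    that element comes from the second factor; hence the flip.\<close>
  have pr: "bilinear_map R M M M ?pr"
    by (rule bilinear_map_compose[OF bilinear_map_flip[OF r] linear_map_id T])
  have sc: "bilinear_map R M M M ?sc"
    by (rule bilinear_map_compose[OF l T linear_map_id])
  have ve: "bilinear_map R M M M ?ve"
    by (rule bilinear_map_compose[OF H T T])
  have star: "bilinear_map R M M M ?star"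
    by (intro bilinear_map_sum modM sc pr ve)
  \<comment> \<open>This is \<open>?box\<close> written with projections, so bilinearity follows by
    composition, addition and pairing.\<close>
  have "bilinear_map R (direct_sum M M) (direct_sum M M) (direct_sum M M)
      (\<lambda>p q. (?star (fst p) (fst q), ?sc (fst p) (snd q) \<oplus>\<^bsub>M\<^esub> ?pr (snd p) (fst q)))"
    by (intro bilinear_map_Pair bilinear_map_sum modM
        bilinear_map_compose[OF star linear_map_fst linear_map_fst]
        bilinear_map_compose[OF sc linear_map_fst linear_map_snd]
        bilinear_map_compose[OF pr linear_map_snd linear_map_fst])
  then have box: "nonassoc_algebra R (direct_sum M M) ?box"
    by (simp add: nonassoc_algebra_def module_direct_sum modM case_prod_beta')
  have T_fst: "linear_map R (direct_sum M M) A (\<lambda>p. T (fst p))"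
    by (rule linear_map_compose[OF linear_map_fst T])
  \<comment> \<open>For multiplicativity, the first components agree by the Rota-Baxter identity,
    and the second components are both \<open>?star\<close> by definition.\<close>
  have graph: "algebra_hom R (direct_sum M M) ?box (direct_sum A M) ?twisted
      (\<lambda>p. (T (fst p), fst p))"
    using linear_map_Pair[OF T_fst linear_map_fst]
    by (auto simp: algebra_hom_def rota_baxter)
  \<comment> \<open>The first components agree again by the Rota-Baxter identity; in the second,
    \<open>?sc\<close> and \<open>?pr\<close> are the two actions through \<open>T\<close>, with no
    term in \<open>H\<close>.\<close>
  have action: "algebra_hom R (direct_sum M M) ?box (direct_sum A M) ?semi
      (\<lambda>p. (T (fst p), snd p))"
    using linear_map_Pair[OF T_fst linear_map_snd]
    by (auto simp: algebra_hom_def rota_baxter)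
  \<comment> \<open>The second component of \<open>graph\<close> recovers the first entry of a pair,
    that of \<open>action\<close> the second entry. Hence the common kernel is zero even when
    \<open>T\<close> is not injective.\<close>
  have "in_category R rels (direct_sum M M) ?box"
    by (rule in_category_jointly_injective[OF assms(2) box twisted semi graph action]) auto
  then show ?thesis
    using modM pr sc ve by (simp add: ns_algebra_def)
qed

end
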